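(* Let $\lambda>0$, $b_0>0$ and $a_0>0$. Define $$\psi_\infty:=\ln b_0-\frac{a_0}{2}\,\frac{\ln\lambda-\ln a_0}{\lambda-a_0}\quad\text{if }a_0\neq\lambda,\qquad \psi_\infty:=\ln b_0-\frac12\quad\text{if }a_0=\lambda.$$ Let $u(t,x)$ be the solution of $\partial_tu=\partial_{xx}u+\lambda u\ln(u^2)$ on $(0,\infty)\times\mathbb{R}$ starting from $u_0(x)=b_0e^{-\frac{a_0}{2}x^2}$. (i) If $\psi_\infty<0$, then there is superexponential decay in the sense that, as $t\to\infty$, $$\|u(t,\cdot)\|_{L^\infty}=\max_{x\in\mathbb{R}}u(t,x)\sim e^{\frac12}e^{\psi_\infty e^{2\lambda t}},\qquad \|u(t,\cdot)\|_{L^1}\sim\sqrt{\frac{2\pi}{\lambda}}\,e^{\frac12}e^{\psi_\infty e^{2\lambda t}}.$$ (ii) If $\psi_\infty=0$, then, with $\varphi(x)=e^{\frac12}e^{-\frac\lambda2x^2}$, $$\|u(t,\cdot)-\varphi\|_{L^\infty}+\|u(t,\cdot)-\varphi\|_{L^1}\longrightarrow0\quad\text{as }t\to\infty.$$ (iii) If $\psi_\infty>0$, then there is superexponential growth in the sense that, for all $R>0$, as $t\to\infty$, $$\min_{|x|\le R}u(t,x)\sim e^{\frac12}e^{\psi_\infty e^{2\lambda t}}e^{-\frac\lambda2R^2},\qquad \|u(t,\cdot)\|_{L^1}\sim\sqrt{\frac{2\pi}{\lambda}}\,e^{\frac12}e^{\psi_\infty e^{2\lambda t}}.$$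
   Context: Here $f(t)\sim g(t)$ as $t\to\infty$ means $f(t)/g(t)\to1$. Norms are over $\mathbb{R}$. The nonlinearity $z\mapsto\lambda z\ln(z^2)$ is extended by the value $0$ at $z=0$. Notion of solution: let $u_0$ be continuous and bounded, with continuous and bounded derivative, and bounded and piecewise continuous second derivative. A (global) solution starting from $u_0$ is a function $u:[0,\infty)\times\mathbb{R}\to\mathbb{R}$ such that, for every $T>0$: $u$ is continuous and bounded on $[0,T]\times\mathbb{R}$; $u_t,u_x,u_{xx}$ exist and are continuous on $(0,T]\times\mathbb{R}$; $u$ satisfies the equation on $(0,T]\times\mathbb{R}$; $u(t,x)$ is uniformly bounded as $|x|\to\infty$ for $t\in[0,T]$; and $u(0,\cdot)=u_0$. For $u_0\ge0$ such a solution exists and is unique. For the Gaussian datum above, the solution is $$u(t,x)=e^{\psi(t)e^{2\lambda t}}e^{-\frac{a(t)}2x^2},\qquad a(t)=\lambda\frac{a_0e^{2\lambda t}}{\lambda-a_0+a_0e^{2\lambda t}},$$ with $\psi(t)=\ln b_0-\frac{a_0}{2}\frac{\ln\lambda-\ln(a_0+(\lambda-a_0)e^{-2\lambda t})}{\lambda-a_0}$ if $a_0\neq\lambda$ and $\psi(t)=\ln b_0-\frac12(1-e^{-2\lambda t})$ if $a_0=\lambda$. *)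

theory Defs
  imports
    "HOL-Probability.Essential_Supremum"
    "HOL-Library.Landau_Symbols"
begin

definition log_nonlinearity :: "real \<Rightarrow> real \<Rightarrow> real" where
  "log_nonlinearity lam z = (if z = 0 then 0 else lam * z * ln (z\<^sup>2))"

(* Global classical solutions of u_t = u_xx + lam u ln(u^2) starting from u0.  A function on
   [0,\<infinity>) \<times> R is represented by a total curried function u t x whose values at t < 0 are
   irrelevant: all derivatives are taken at t > 0, where u is given on both sides of t.
   The regularity of u0 (C^1 with bounded derivative, piecewise continuous bounded second
   derivative) is a standing assumption on the data and not part of this predicate. *)
definition log_heat_solution ::
    "real \<Rightarrow> (real \<Rightarrow> real) \<Rightarrow> (real \<Rightarrow> real \<Rightarrow> real) \<Rightarrow> bool" where
  "log_heat_solution lam u0 u \<longleftrightarrow>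
     (\<forall>T>0.
        continuous_on ({0..T} \<times> UNIV) (\<lambda>(t, x). u t x) \<and>
        bounded ((\<lambda>(t, x). u t x) ` ({0..T} \<times> UNIV)) \<and>
        (\<forall>t\<in>{0<..T}. \<forall>x.
           (\<lambda>s. u s x) differentiable (at t) \<and>
           u t differentiable (at x) \<and>
           deriv (u t) differentiable (at x)) \<and>
        continuous_on ({0<..T} \<times> UNIV) (\<lambda>(t, x). deriv (\<lambda>s. u s x) t) \<and>
        continuous_on ({0<..T} \<times> UNIV) (\<lambda>(t, x). deriv (u t) x) \<and>
        continuous_on ({0<..T} \<times> UNIV) (\<lambda>(t, x). deriv (deriv (u t)) x) \<and>
        (\<forall>t\<in>{0<..T}. \<forall>x.
           deriv (\<lambda>s. u s x) t = deriv (deriv (u t)) x + log_nonlinearity lam (u t x)) \<and>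
        (\<exists>r M. \<forall>t\<in>{0..T}. \<forall>x. \<bar>x\<bar> \<ge> r \<longrightarrow> \<bar>u t x\<bar> \<le> M)) \<and>
     (\<forall>x. u 0 x = u0 x)"

definition psi_infinity :: "real \<Rightarrow> real \<Rightarrow> real \<Rightarrow> real" where
  "psi_infinity lam a0 b0 =
     (if a0 \<noteq> lam then ln b0 - a0 / 2 * ((ln lam - ln a0) / (lam - a0)) else ln b0 - 1 / 2)"

(* Both norms take values in [0,\<infinity>], so that convergence of a norm to 0 includes its finiteness. *)

definition Linf_norm :: "(real \<Rightarrow> real) \<Rightarrow> ennreal" where
  "Linf_norm f = esssup lborel (\<lambda>x. ennreal \<bar>f x\<bar>)"

definition L1_norm :: "(real \<Rightarrow> real) \<Rightarrow> ennreal" where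
  "L1_norm f = (\<integral>\<^sup>+ x. ennreal \<bar>f x\<bar> \<partial>lborel)"

definition is_max_value :: "('a \<Rightarrow> real) \<Rightarrow> 'a set \<Rightarrow> real \<Rightarrow> bool" where
  "is_max_value f S m \<longleftrightarrow> m \<in> f ` S \<and> (\<forall>x\<in>S. f x \<le> m)"

definition is_min_value :: "('a \<Rightarrow> real) \<Rightarrow> 'a set \<Rightarrow> real \<Rightarrow> bool" where
  "is_min_value f S m \<longleftrightarrow> m \<in> f ` S \<and> (\<forall>x\<in>S. m \<le> f x)"

end

theory Submission
  imports Defs "HOL-Probability.Distributions" "HOL-Real_Asymp.Real_Asymp"
begin

text \<open>The slope of \<open>z \<mapsto> \<lambda> z ln (z\<^sup>2)\<close> is \<open>-\<infinity>\<close> at \<open>0\<close>, so on bounded sets the nonlinearity is one-sided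
  Lipschitz although it is not Lipschitz. This suffices for a maximum principle for differences of
  bounded solutions, hence for uniqueness, and \<open>u\<close> is the explicit Gaussian
  \<open>exp (P(t) - a(t) x\<^sup>2 / 2)\<close> with \<open>a' = 2\<lambda>a - 2a\<^sup>2\<close> and \<open>P' = 2\<lambda>P - a\<close>. All claims then follow
  from \<open>a(t) \<longlongrightarrow> \<lambda>\<close> and \<open>P(t) - \<psi>\<^sub>\<infinity> e\<^bsup>2\<lambda>t\<^esup> \<longlongrightarrow> 1/2\<close>.\<close>

subsection \<open>Uniqueness\<close>

text \<open>Up to the factor \<open>lam\<close> the function is g(y) = y ln(y^2), whose slope 2
  ln|y| + 2 away from 0 is at most 2 ln B + 2 on [-B, B]. The slope has no lower bound near 0, so
  the estimate is one-sided. As g is odd, it suffices to treat 0 < w \<le> z and pairs straddling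
  0.\<close>

lemma log_nonlinearity_one_sided_lipschitz:
  assumes "0 \<le> lam" and "0 < B" and "\<bar>w\<bar> \<le> B" and "\<bar>z\<bar> \<le> B" and "w \<le> z"
  shows "log_nonlinearity lam z - log_nonlinearity lam w \<le> lam * (2 * ln B + 2) * (z - w)"
proof -
  define g where "g = (\<lambda>y::real. y * ln (y\<^sup>2))"
  have g_minus: "g (- y) = - g y" for y
    by (simp add: g_def)
  have g_pos: "g y = 2 * (y * ln y)" if "0 < y" for y
    using that by (simp add: g_def ln_realpow)
  have pos: "g z - g w \<le> (2 * ln B + 2) * (z - w)" if "0 < w" "w \<le> z" "z \<le> B" for w z
  proof -
    \<comment> \<open>Uses z ln z - w ln w = (z - w) ln z + w (ln z - ln w): the first term is at
      most (z - w) ln B, the second at most z - w.\<close>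
    have "ln z - ln w \<le> z / w - 1"
      using that ln_le_minus_one[of "z / w"] by (simp add: ln_div)
    then have "w * (ln z - ln w) \<le> w * (z / w - 1)"
      using that by (intro mult_left_mono) auto
    then have "w * (ln z - ln w) \<le> z - w"
      using that by (simp add: algebra_simps)
    moreover have "(z - w) * ln z \<le> (z - w) * ln B"
      using that by (intro mult_left_mono) auto
    ultimately show ?thesis
      using that by (simp add: g_pos algebra_simps)
  qed
  have zero: "g y \<le> (2 * ln B + 2) * y" if "0 \<le> y" "y \<le> B" for y
  proof (cases "y = 0")
    case False
    then have "y * ln y \<le> y * ln B"
      using that by (intro mult_left_mono) auto
    moreover have "(2 * ln B + 2) * y = 2 * (y * ln B) + 2 * y"
      by (simp add: algebra_simps)
    ultimately show ?thesis
      using False that g_pos[of y] by linarith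
  qed (simp add: g_def)
  consider "0 < w" | "z < 0" | "w \<le> 0" "0 \<le> z"
    by linarith
  then have "g z - g w \<le> (2 * ln B + 2) * (z - w)"
  proof cases
    case 1
    then show ?thesis using pos[of w z] assms by auto
  next
    case 2
    then show ?thesis using pos[of "- z" "- w"] assms by (simp add: g_minus)
  next
    \<comment> \<open>The pair is split at 0, where g vanishes: \<open>zero\<close> is applied to z
      and, by oddness, to -w, and the two bounds add up.\<close>
    case 3
    then show ?thesis
      using zero[of z] zero[of "- w"] assms by (simp add: g_minus algebra_simps)
  qed
  then have "lam * (g z - g w) \<le> lam * ((2 * ln B + 2) * (z - w))"
    using assms by (intro mult_left_mono)
  moreover have "log_nonlinearity lam y = lam * g y" for y
    by (simp add: log_nonlinearity_def g_def)
  ultimately show ?thesis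
    by (simp add: algebra_simps)
qed

text \<open>Since f' vanishes at x, a positive f'' would make f' positive just to the right of x,
  and by the mean value theorem f would rise above its maximum there.\<close>

lemma second_derivative_nonpos_at_local_max:
  fixes f f' :: "real \<Rightarrow> real"
  assumes f: "\<And>y. (f has_real_derivative f' y) (at y)"
    and f': "(f' has_real_derivative f'') (at x)"
    and d: "0 < d" and max: "\<And>y. \<bar>x - y\<bar> < d \<Longrightarrow> f y \<le> f x"
  shows "f'' \<le> 0"
proof (rule ccontr)
  assume "\<not> f'' \<le> 0"
  moreover have "f' x = 0"
    using DERIV_local_max[OF f d] max by blast
  ultimately obtain e where e: "e > 0" "\<And>h. 0 < h \<Longrightarrow> h < e \<Longrightarrow> 0 < f' (x + h)"
    using DERIV_pos_inc_right[OF f'] by auto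
  define h where "h = min (d / 2) (e / 2)"
  have h: "0 < h" "h < d" "h < e"
    using d e by (auto simp: h_def)
  obtain z where z: "x < z" "z < x + h" "f (x + h) - f x = (x + h - x) * f' z"
    using MVT2[of x "x + h" f f'] f h by auto
  have "0 < f' z"
    using e(2)[of "z - x"] z h by auto
  then have "0 < f (x + h) - f x"
    using z h by simp
  moreover have "f (x + h) \<le> f x"
    using max[of "x + h"] h by auto
  ultimately show False
    by simp
qed

text \<open>The barrier \<open>\<epsilon> (x\<^sup>2 + 3 t + 1)\<close> is a strict supersolution of the heat equation, which forces
  an interior maximum although the spatial domain is unbounded.\<close>

lemma bounded_maximum_principle:
  fixes w :: "real \<Rightarrow> real \<Rightarrow> real"
  assumes cont: "continuous_on ({0..T} \<times> UNIV) (\<lambda>(t, x). w t x)"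
    and bound: "\<And>t x. t \<in> {0..T} \<Longrightarrow> w t x \<le> B"
    and init: "\<And>x. w 0 x \<le> 0"
    and dt: "\<And>t x. t \<in> {0<..T} \<Longrightarrow> ((\<lambda>s. w s x) has_real_derivative wt t x) (at t)"
    and dx: "\<And>t x. t \<in> {0<..T} \<Longrightarrow> (w t has_real_derivative wx t x) (at x)"
    and dxx: "\<And>t x. t \<in> {0<..T} \<Longrightarrow> (wx t has_real_derivative wxx t x) (at x)"
    and ineq: "\<And>t x. t \<in> {0<..T} \<Longrightarrow> 0 < w t x \<Longrightarrow> wt t x \<le> wxx t x + K * w t x"
    and t1: "t1 \<in> {0..T}"
  shows "w t1 x1 \<le> 0"
proof (rule ccontr)
  assume "\<not> w t1 x1 \<le> 0"
  then have w1: "0 < w t1 x1" by simp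
  have bar1: "0 < x1\<^sup>2 + 3 * t1 + 1"
    using t1 by (auto intro: add_nonneg_pos)
  \<comment> \<open>This value makes \<open>z\<close> vanish at (t1, x1), so the maximum of
    \<open>z\<close> over any box containing that point is nonnegative. In \<open>z\<close>, the
    factor exp(-K t) absorbs the term K w of the differential inequality.\<close>
  define \<epsilon> where "\<epsilon> = exp (- K * t1) * w t1 x1 / (x1\<^sup>2 + 3 * t1 + 1)"
  have \<epsilon>: "0 < \<epsilon>"
    using w1 bar1 by (simp add: \<epsilon>_def)
  define z where "z = (\<lambda>t x. exp (- K * t) * w t x - \<epsilon> * (x\<^sup>2 + 3 * t + 1))"
  have z1: "z t1 x1 = 0"
    using bar1 by (simp add: z_def \<epsilon>_def)
  define C where "C = exp (\<bar>K\<bar> * T) * \<bar>B\<bar>"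
  have C: "exp (- K * t) * w t x \<le> C" if "t \<in> {0..T}" for t x
  proof -
    have "- K * t \<le> \<bar>K\<bar> * T"
      using that by (smt (verit) atLeastAtMost_iff mult_left_mono mult_minus_left mult_right_mono)
    then have "exp (- K * t) * w t x \<le> exp (- K * t) * \<bar>B\<bar>"
      using bound[OF that, of x] by (intro mult_left_mono) auto
    also have "\<dots> \<le> C"
      unfolding C_def using \<open>- K * t \<le> \<bar>K\<bar> * T\<close> by (intro mult_right_mono) auto
    finally show ?thesis .
  qed
  \<comment> \<open>For |x| \<ge> r the barrier exceeds the bound \<open>C\<close> on exp(-K t) w,
    so \<open>z\<close> is negative there; the summand |x1| keeps x1 inside the box.\<close>
  define r where "r = \<bar>x1\<bar> + sqrt (C / \<epsilon>) + 1"
  have C0: "0 \<le> C" by (simp add: C_def)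
  have r: "\<bar>x1\<bar> \<le> r" "0 < r"
    using C0 \<epsilon> by (auto simp: r_def add_nonneg_pos)
  have far: "z t x < 0" if "t \<in> {0..T}" "r \<le> \<bar>x\<bar>" for t x
  proof -
    have "sqrt (C / \<epsilon>) \<le> \<bar>x\<bar>"
      using that by (simp add: r_def)
    then have "(sqrt (C / \<epsilon>))\<^sup>2 \<le> \<bar>x\<bar>\<^sup>2"
      using C0 \<epsilon> by (intro power_mono) auto
    then have "C \<le> \<epsilon> * x\<^sup>2"
      using C0 \<epsilon> by (simp add: field_simps)
    moreover have "0 \<le> \<epsilon> * (3 * t)"
      using \<epsilon> that by simp
    ultimately show ?thesis
      using C[OF that(1), of x] \<epsilon> by (simp add: z_def algebra_simps)
  qed
  define S where "S = {0..T} \<times> {- r..r}"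
  have "continuous_on S (\<lambda>p. w (fst p) (snd p))"
    by (rule continuous_on_subset[OF cont[unfolded case_prod_beta]]) (auto simp: S_def)
  then have "continuous_on S (\<lambda>p. z (fst p) (snd p))"
    unfolding z_def by (intro continuous_intros)
  moreover have "compact S"
    unfolding S_def by (intro compact_Times compact_Icc)
  moreover have "(t1, x1) \<in> S"
    using t1 r by (auto simp: S_def)
  ultimately obtain p where p: "p \<in> S" "\<forall>q\<in>S. z (fst q) (snd q) \<le> z (fst p) (snd p)"
    using continuous_attains_sup[of S] by blast
  obtain t x where tx: "p = (t, x)" by (cases p)
  have t: "t \<in> {0..T}" and max: "\<And>s y. s \<in> {0..T} \<Longrightarrow> \<bar>y\<bar> \<le> r \<Longrightarrow> z s y \<le> z t x"
    using p tx by (auto simp: S_def abs_le_iff)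
  have z0: "0 \<le> z t x"
    using max[of t1 x1] t1 r z1 by simp
  have x: "\<bar>x\<bar> < r"
    using far[OF t, of x] z0 by linarith
  have "z 0 x < 0"
    using init[of x] \<epsilon> by (auto simp: z_def intro!: le_less_trans[of "w 0 x" 0] mult_pos_pos add_nonneg_pos)
  then have t': "t \<in> {0<..T}"
    using t z0 by (cases "t = 0") auto
  have "0 < \<epsilon> * (x\<^sup>2 + 3 * t + 1)"
    using \<epsilon> t by (auto intro!: mult_pos_pos add_nonneg_pos)
  then have "0 < exp (- K * t) * w t x"
    using z0 by (simp add: z_def)
  then have "0 < w t x"
    by (simp add: zero_less_mult_iff)
  define zt where "zt = exp (- K * t) * (wt t x - K * w t x) - 3 * \<epsilon>"
  have "((\<lambda>s. z s x) has_real_derivative zt) (at t)"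
    unfolding z_def zt_def
    by (rule derivative_eq_intros dt[OF t'] refl)+ (simp add: algebra_simps)
  \<comment> \<open>Only earlier times are compared, because the maximum may lie on the final time t
    = T. This gives a sign for the time derivative instead of its vanishing.\<close>
  then have "0 \<le> zt"
  proof (rule contrapos_pp)
    assume "\<not> 0 \<le> zt"
    then have neg: "zt < 0" by simp
    show "\<not> ((\<lambda>s. z s x) has_real_derivative zt) (at t)"
    proof
      assume "((\<lambda>s. z s x) has_real_derivative zt) (at t)"
      then obtain d where d: "d > 0" "\<And>h. 0 < h \<Longrightarrow> h < d \<Longrightarrow> z t x < z (t - h) x"
        using DERIV_neg_dec_left[OF _ neg] by blast
      \<comment> \<open>The bound h \<le> t keeps t - h in [0, T].\<close>
      define h where "h = min (d / 2) t"
      have "z t x < z (t - h) x"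
        using d t' by (intro d(2)) (auto simp: h_def)
      moreover have "z (t - h) x \<le> z t x"
        using t' d x by (intro max) (auto simp: h_def)
      ultimately show False by simp
    qed
  qed
  moreover have "exp (- K * t) * wxx t x - 2 * \<epsilon> \<le> 0"
  proof (rule second_derivative_nonpos_at_local_max)
    show "(z t has_real_derivative exp (- K * t) * wx t y - \<epsilon> * (2 * y)) (at y)" for y
      unfolding z_def by (rule derivative_eq_intros dx[OF t'] refl)+ simp
    show "((\<lambda>y. exp (- K * t) * wx t y - \<epsilon> * (2 * y)) has_real_derivative
        exp (- K * t) * wxx t x - 2 * \<epsilon>) (at x)"
      by (rule derivative_eq_intros dxx[OF t'] refl)+ simp
    show "0 < r - \<bar>x\<bar>"
      using x by simp
    show "z t y \<le> z t x" if "\<bar>x - y\<bar> < r - \<bar>x\<bar>" for y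
      using that t by (intro max) auto
  qed
  \<comment> \<open>Together with the second-order condition this gives zt \<le> 2\<epsilon> -
    3\<epsilon> < 0: the coefficient 3 of t in the barrier beats the second derivative 2 of
    x^2.\<close>
  moreover have "exp (- K * t) * (wt t x - K * w t x) \<le> exp (- K * t) * wxx t x"
    using ineq[OF t' \<open>0 < w t x\<close>] by (intro mult_left_mono) auto
  ultimately show False
    using \<epsilon> unfolding zt_def by linarith
qed

text \<open>Where the difference w = u - v is positive, the one-sided Lipschitz bound on a common
  range [-B, B] yields w_t \<le> w_xx + K w. As w starts from 0 and is bounded, the maximum
  principle gives w \<le> 0. Exchanging u and v then gives uniqueness.\<close>

lemma log_heat_solution_le:
  assumes lam: "0 \<le> lam" and u: "log_heat_solution lam u0 u" and v: "log_heat_solution lam u0 v"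
    and t: "0 \<le> t"
  shows "u t x \<le> v t x"
proof -
  \<comment> \<open>The solution property is stated for positive horizons, so t = 0 needs a horizon
    beyond t.\<close>
  define T where "T = t + 1"
  have T: "0 < T" "t \<in> {0..T}"
    using t by (auto simp: T_def)
  note uT = u[unfolded log_heat_solution_def, THEN conjunct1, rule_format, OF T(1)]
  note vT = v[unfolded log_heat_solution_def, THEN conjunct1, rule_format, OF T(1)]
  have "bounded ((\<lambda>(t, x). u t x) ` ({0..T} \<times> UNIV) \<union> (\<lambda>(t, x). v t x) ` ({0..T} \<times> UNIV))"
    using uT vT by simp
  then obtain B where B0: "0 < B" and B: "\<And>s y. s \<in> {0..T} \<Longrightarrow> \<bar>u s y\<bar> \<le> B \<and> \<bar>v s y\<bar> \<le> B"
    unfolding bounded_pos by (force simp: image_def)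
  define dt where "dt = (\<lambda>(f :: real \<Rightarrow> real \<Rightarrow> real) s y. deriv (\<lambda>s. f s y) s)"
  have diff: "((\<lambda>s. f s y) has_real_derivative dt f s y) (at s)"
      "(f s has_real_derivative deriv (f s) y) (at y)"
      "(deriv (f s) has_real_derivative deriv (deriv (f s)) y) (at y)"
      "dt f s y = deriv (deriv (f s)) y + log_nonlinearity lam (f s y)"
    if "s \<in> {0<..T}" "f = u \<or> f = v" for f s y
    using uT vT that unfolding dt_def by (auto intro!: DERIV_deriv_iff_real_differentiable[THEN iffD2])
  have "u t x - v t x \<le> 0"
  proof (rule bounded_maximum_principle[where w = "\<lambda>t x. u t x - v t x"
        and wt = "\<lambda>t x. dt u t x - dt v t x" and wx = "\<lambda>t x. deriv (u t) x - deriv (v t) x"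
        and wxx = "\<lambda>t x. deriv (deriv (u t)) x - deriv (deriv (v t)) x"
        and B = "2 * B" and K = "lam * (2 * ln B + 2)" and T = T])
    show "continuous_on ({0..T} \<times> UNIV) (\<lambda>(t, x). u t x - v t x)"
      using uT vT unfolding case_prod_beta by (intro continuous_on_diff) auto
    show "u s y - v s y \<le> 2 * B" if "s \<in> {0..T}" for s y
      using B[OF that, of y] by linarith
    show "u 0 y - v 0 y \<le> 0" for y
      using u v by (simp add: log_heat_solution_def)
    show "dt u s y - dt v s y \<le> deriv (deriv (u s)) y - deriv (deriv (v s)) y
        + lam * (2 * ln B + 2) * (u s y - v s y)" if "s \<in> {0<..T}" "0 < u s y - v s y" for s y
      using log_nonlinearity_one_sided_lipschitz[OF lam B0, of "v s y" "u s y"] B[of s y] that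
        diff(4)[of s u y] diff(4)[of s v y] by auto
  qed (use T in \<open>auto intro!: DERIV_diff diff\<close>)
  then show ?thesis by simp
qed

lemma log_heat_solution_unique:
  assumes "0 \<le> lam" "log_heat_solution lam u0 u" "log_heat_solution lam u0 v" "0 \<le> t"
  shows "u t = v t"
proof (rule ext)
  show "u t x = v t x" for x
    using log_heat_solution_le[OF assms] log_heat_solution_le[OF assms(1,3,2,4)] by (rule antisym)
qed

subsection \<open>The Gaussian solution\<close>

definition gauss_denom :: "real \<Rightarrow> real \<Rightarrow> real \<Rightarrow> real" where
  "gauss_denom lam a0 t = a0 + (lam - a0) * exp (- 2 * lam * t)"

text \<open>The paper's \<open>a(t)\<close>, with numerator and denominator divided by \<open>e\<^bsup>2\<lambda>t\<^esup>\<close>.\<close>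

definition gauss_rate :: "real \<Rightarrow> real \<Rightarrow> real \<Rightarrow> real" where
  "gauss_rate lam a0 t = lam * a0 / gauss_denom lam a0 t"

text \<open>The antiderivative of -a(t) exp(-2\<lambda>t) with value ln b0 at t = 0. The second
  branch is the limit of the first as a0 tends to \<lambda>.\<close>

definition gauss_psi :: "real \<Rightarrow> real \<Rightarrow> real \<Rightarrow> real \<Rightarrow> real" where
  "gauss_psi lam a0 b0 t =
     (if a0 \<noteq> lam then ln b0 - a0 / 2 * ((ln lam - ln (gauss_denom lam a0 t)) / (lam - a0))
      else ln b0 - 1 / 2 * (1 - exp (- 2 * lam * t)))"

text \<open>Variation of constants for P' = 2\<lambda>P - a: the homogeneous solution
  exp(2\<lambda>t) times the variable coefficient \<psi>(t).\<close>

definition gauss_log_amplitude :: "real \<Rightarrow> real \<Rightarrow> real \<Rightarrow> real \<Rightarrow> real" where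
  "gauss_log_amplitude lam a0 b0 t = gauss_psi lam a0 b0 t * exp (2 * lam * t)"

definition gauss_solution :: "real \<Rightarrow> real \<Rightarrow> real \<Rightarrow> real \<Rightarrow> real \<Rightarrow> real" where
  "gauss_solution lam a0 b0 t x =
     exp (gauss_log_amplitude lam a0 b0 t) * exp (- (gauss_rate lam a0 t / 2) * x\<^sup>2)"

section \<open>Differential equations for the rate and the amplitude\<close>

lemma gauss_denom_pos:
  assumes "0 < lam" "0 < a0" "0 \<le> t"
  shows "0 < gauss_denom lam a0 t"
proof -
  have "exp (- 2 * lam * t) \<le> 1"
    using assms by simp
  \<comment> \<open>For t \<ge> 0 the denominator is a convex combination of a0 and
    \<lambda>.\<close>
  then have "0 < a0 * (1 - exp (- 2 * lam * t)) + lam * exp (- 2 * lam * t)"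
    using assms by (intro add_nonneg_pos) auto
  then show ?thesis
    by (simp add: gauss_denom_def algebra_simps)
qed

lemma gauss_rate_pos: "0 < lam \<Longrightarrow> 0 < a0 \<Longrightarrow> 0 \<le> t \<Longrightarrow> 0 < gauss_rate lam a0 t"
  by (simp add: gauss_rate_def gauss_denom_pos)

lemma gauss_rate_deriv:
  assumes "0 < lam" "0 < a0" "0 \<le> t"
  shows "(gauss_rate lam a0 has_real_derivative
           2 * lam * gauss_rate lam a0 t - 2 * (gauss_rate lam a0 t)\<^sup>2) (at t)"
proof -
  define D where "D = gauss_denom lam a0"
  define s where "s = exp (- 2 * lam * t)"
  have D: "0 < D t"
    using gauss_denom_pos[OF assms] by (simp add: D_def)
  have D': "(D has_real_derivative (lam - a0) * (s * (- 2 * lam))) (at t)"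
    unfolding D_def gauss_denom_def s_def by (rule derivative_eq_intros refl | simp)+
  have "((\<lambda>t. lam * a0 / D t) has_real_derivative
      - (lam * a0 * ((lam - a0) * (s * (- 2 * lam)))) / (D t)\<^sup>2) (at t)"
    by (rule derivative_eq_intros D' refl | use D in \<open>simp add: power2_eq_square\<close>)+
  moreover have "- (lam * a0 * ((lam - a0) * (s * (- 2 * lam)))) / (D t)\<^sup>2
      = 2 * lam * (lam * a0) * ((lam - a0) * s) / (D t)\<^sup>2"
    by simp
  \<comment> \<open>Eliminating the exponential leaves an expression in D alone, hence in a =
    \<lambda> a0 / D.\<close>
  moreover have "(lam - a0) * s = D t - a0"
    by (simp add: D_def gauss_denom_def s_def)
  moreover have "2 * lam * (lam * a0) * (D t - a0) / (D t)\<^sup>2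
      = 2 * lam * (lam * a0 / D t) - 2 * (lam * a0 / D t)\<^sup>2"
    using D by (simp add: field_simps power2_eq_square)
  ultimately show ?thesis
    unfolding gauss_rate_def[abs_def] D_def by simp
qed

text \<open>For a0 \<noteq> \<lambda> the factor \<lambda> - a0 in the derivative of the denominator
  \<open>D\<close> cancels the division by \<lambda> - a0. For a0 = \<lambda> the rate is constantly
  \<lambda>.\<close>

lemma gauss_psi_deriv:
  assumes "0 < lam" "0 < a0" "0 \<le> t"
  shows "(gauss_psi lam a0 b0 has_real_derivative
           - gauss_rate lam a0 t * exp (- 2 * lam * t)) (at t)"
proof (cases "a0 = lam")
  case True
  have "((\<lambda>t. ln b0 - 1 / 2 * (1 - exp (- 2 * lam * t))) has_real_derivative
      - lam * exp (- 2 * lam * t)) (at t)"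
    by (rule derivative_eq_intros refl | simp)+
  then show ?thesis
    using assms by (simp add: gauss_psi_def[abs_def] True gauss_rate_def gauss_denom_def)
next
  case False
  define D where "D = gauss_denom lam a0"
  define s where "s = exp (- 2 * lam * t)"
  have D: "0 < D t"
    using gauss_denom_pos[OF assms] by (simp add: D_def)
  have D': "(D has_real_derivative (lam - a0) * (s * (- 2 * lam))) (at t)"
    unfolding D_def gauss_denom_def s_def by (rule derivative_eq_intros refl | simp)+
  have "((\<lambda>t. ln (D t)) has_real_derivative 1 / D t * ((lam - a0) * (s * (- 2 * lam)))) (at t)"
    using D by (intro DERIV_chain2[OF DERIV_ln_divide] D')
  from DERIV_cdivide[OF DERIV_diff[OF DERIV_const[of "ln lam"] this], of "lam - a0"]
  have "((\<lambda>t. ln b0 - a0 / 2 * ((ln lam - ln (D t)) / (lam - a0))) has_real_derivative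
      0 - a0 / 2 * ((0 - 1 / D t * ((lam - a0) * (s * (- 2 * lam)))) / (lam - a0))) (at t)"
    by (intro DERIV_diff DERIV_const DERIV_cmult)
  moreover have "0 - a0 / 2 * ((0 - 1 / D t * ((lam - a0) * (s * (- 2 * lam)))) / (lam - a0))
      = - (lam * a0 / D t) * s"
    using False by simp
  ultimately have "((\<lambda>t. ln b0 - a0 / 2 * ((ln lam - ln (D t)) / (lam - a0))) has_real_derivative
      - (lam * a0 / D t) * s) (at t)"
    by simp
  then show ?thesis
    using False by (simp add: gauss_psi_def[abs_def] gauss_rate_def D_def s_def)
qed

lemma gauss_log_amplitude_deriv:
  assumes "0 < lam" "0 < a0" "0 \<le> t"
  shows "(gauss_log_amplitude lam a0 b0 has_real_derivative
           2 * lam * gauss_log_amplitude lam a0 b0 t - gauss_rate lam a0 t) (at t)"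
  unfolding gauss_log_amplitude_def[abs_def]
  by (rule derivative_eq_intros gauss_psi_deriv[OF assms] refl)+ (simp add: algebra_simps flip: exp_add)

lemma gauss_psi_0: "0 < lam \<Longrightarrow> gauss_psi lam a0 b0 0 = ln b0"
  by (simp add: gauss_psi_def gauss_denom_def)

lemma gauss_rate_0: "0 < lam \<Longrightarrow> gauss_rate lam a0 0 = a0"
  by (simp add: gauss_rate_def gauss_denom_def)

text \<open>For U = exp(P - a x^2/2) every term of the equation is U times a polynomial in x^2: U_t
  gives P' - a' x^2/2, U_xx gives a^2 x^2 - a, and the nonlinearity gives 2\<lambda>P - \<lambda> a
  x^2. Matching coefficients yields exactly the equations for P and a.\<close>

lemma log_heat_solution_gauss:
  assumes pos: "0 < lam" "0 < a0" "0 < b0"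
  shows "log_heat_solution lam (\<lambda>x. b0 * exp (- (a0 / 2) * x\<^sup>2)) (gauss_solution lam a0 b0)"
proof -
  define a where "a = gauss_rate lam a0"
  define P where "P = gauss_log_amplitude lam a0 b0"
  define U where "U = gauss_solution lam a0 b0"
  have U: "U t x = exp (P t - a t * (x\<^sup>2 / 2))" for t x
    by (simp add: U_def gauss_solution_def P_def a_def flip: exp_add)
  have a': "(a has_real_derivative 2 * lam * a t - 2 * (a t)\<^sup>2) (at t)" if "0 \<le> t" for t
    using gauss_rate_deriv[OF pos(1,2) that] by (simp add: a_def)
  have P': "(P has_real_derivative 2 * lam * P t - a t) (at t)" if "0 \<le> t" for t
    using gauss_log_amplitude_deriv[OF pos(1,2) that] by (simp add: a_def P_def)
  \<comment> \<open>The derivative formulas hold at t = 0 as well, so continuity extends to the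
    initial time.\<close>
  have cont_a: "continuous_on {0..} a" and cont_P: "continuous_on {0..} P"
    using a' P' by (auto intro!: DERIV_atLeastAtMost_imp_continuous_on
        continuous_at_imp_continuous_on DERIV_isCont)
  have Ut: "((\<lambda>t. U t x) has_real_derivative
      U t x * (2 * lam * P t - a t - (lam * a t - (a t)\<^sup>2) * x\<^sup>2)) (at t)" if "0 \<le> t" for t x
    unfolding U by (rule derivative_eq_intros a'[OF that] P'[OF that] refl)+ (simp add: algebra_simps)
  have Ux: "(U t has_real_derivative U t x * (- a t * x)) (at x)" for t x
    unfolding U[abs_def] by (rule derivative_eq_intros refl | simp)+
  have dU: "deriv (U t) = (\<lambda>x. U t x * (- a t * x))" for t
    using Ux by (auto intro: DERIV_imp_deriv)
  have Uxx: "(deriv (U t) has_real_derivative U t x * ((a t)\<^sup>2 * x\<^sup>2 - a t)) (at x)" for t x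
    unfolding dU by (rule derivative_eq_intros Ux refl)+ (simp add: algebra_simps power2_eq_square)
  have cont: "continuous_on ({0..} \<times> UNIV) (\<lambda>p. a (fst p))"
      "continuous_on ({0..} \<times> UNIV) (\<lambda>p. P (fst p))"
    by (auto intro!: continuous_on_compose2[OF cont_a] continuous_on_compose2[OF cont_P] continuous_intros)
  have cont_U: "continuous_on ({0..} \<times> UNIV) (\<lambda>p. U (fst p) (snd p))"
    unfolding U by (intro continuous_intros cont) auto
  have sub: "{0<..T} \<times> UNIV \<subseteq> {0::real..} \<times> (UNIV :: real set)" for T
    by auto
  have "log_heat_solution lam (\<lambda>x. b0 * exp (- (a0 / 2) * x\<^sup>2)) U"
    unfolding log_heat_solution_def case_prod_beta
  proof (intro conjI allI impI ballI)
    fix T :: real assume "0 < T"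
    show "continuous_on ({0..T} \<times> UNIV) (\<lambda>p. U (fst p) (snd p))"
      by (rule continuous_on_subset[OF cont_U]) auto
    \<comment> \<open>As a > 0, U is at most exp(P), so a bound for P on [0, T] bounds U uniformly
      in x.\<close>
    have "compact (P ` {0..T})"
      by (intro compact_continuous_image continuous_on_subset[OF cont_P]) auto
    then obtain B where B: "\<And>t. t \<in> {0..T} \<Longrightarrow> P t \<le> B"
      using compact_imp_bounded[THEN bounded_imp_bdd_above] unfolding bdd_above_def by (metis imageI)
    have UB: "\<bar>U t x\<bar> \<le> exp B" if "t \<in> {0..T}" for t x
    proof -
      have "0 \<le> a t * (x\<^sup>2 / 2)"
        using gauss_rate_pos[OF pos(1,2), of t] that by (simp add: a_def)
      then show ?thesis
        using B[OF that] by (simp add: U)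
    qed
    then show "bounded ((\<lambda>p. U (fst p) (snd p)) ` ({0..T} \<times> UNIV))"
      by (intro boundedI[of _ "exp B"]) auto
    show "\<exists>r M. \<forall>t\<in>{0..T}. \<forall>x. r \<le> \<bar>x\<bar> \<longrightarrow> \<bar>U t x\<bar> \<le> M"
      using UB by blast
    have "continuous_on ({0<..T} \<times> UNIV) (\<lambda>p. U (fst p) (snd p) *
        (2 * lam * P (fst p) - a (fst p) - (lam * a (fst p) - (a (fst p))\<^sup>2) * (snd p)\<^sup>2))"
      by (rule continuous_on_subset[OF _ sub]) (intro continuous_intros cont cont_U)
    then show "continuous_on ({0<..T} \<times> UNIV) (\<lambda>p. deriv (\<lambda>s. U s (snd p)) (fst p))"
      by (rule continuous_on_eq) (auto intro!: DERIV_imp_deriv[symmetric] Ut)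
    show "continuous_on ({0<..T} \<times> UNIV) (\<lambda>p. deriv (U (fst p)) (snd p))"
      unfolding dU by (rule continuous_on_subset[OF _ sub]) (intro continuous_intros cont cont_U)
    have "continuous_on ({0<..T} \<times> UNIV) (\<lambda>p. U (fst p) (snd p) * ((a (fst p))\<^sup>2 * (snd p)\<^sup>2 - a (fst p)))"
      by (rule continuous_on_subset[OF _ sub]) (intro continuous_intros cont cont_U)
    then show "continuous_on ({0<..T} \<times> UNIV) (\<lambda>p. deriv (deriv (U (fst p))) (snd p))"
      by (rule continuous_on_eq) (auto intro!: DERIV_imp_deriv[symmetric] Uxx)
    fix t x assume t: "t \<in> {0<..T}"
    then have "0 \<le> t" by simp
    note d = Ut[OF this, of x] Ux[of t x] Uxx[of t x]
    show "(\<lambda>s. U s x) differentiable at t" "U t differentiable at x" "deriv (U t) differentiable at x"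
      using d unfolding real_differentiable_def by blast+
    \<comment> \<open>U is an exponential, so the value assigned at 0 never arises and the logarithm
      returns the exponent.\<close>
    have nonlin: "log_nonlinearity lam (U t x) = lam * U t x * (2 * (P t - a t * (x\<^sup>2 / 2)))"
      by (simp add: log_nonlinearity_def U ln_realpow)
    show "deriv (\<lambda>s. U s x) t = deriv (deriv (U t)) x + log_nonlinearity lam (U t x)"
      unfolding d[THEN DERIV_imp_deriv] nonlin by (simp add: algebra_simps)
  next
    show "U 0 x = b0 * exp (- (a0 / 2) * x\<^sup>2)" for x
      using pos by (simp add: U_def gauss_solution_def gauss_log_amplitude_def gauss_psi_0 gauss_rate_0)
  qed
  then show ?thesis by (simp add: U_def)
qed

section \<open>Limits of the rate and the log-amplitude\<close>

lemma gauss_rate_tendsto: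
  assumes "0 < lam" "0 < a0"
  shows "(gauss_rate lam a0 \<longlongrightarrow> lam) at_top"
  unfolding gauss_rate_def[abs_def] gauss_denom_def using assms by real_asymp

text \<open>With s = exp(-2\<lambda>t) and k = \<lambda> - a0 \<noteq> 0, the difference is a0/(2k)
  times the difference quotient of ln(a0 + k s) at s = 0, whose limit is k/a0. For a0 = \<lambda> it
  is exactly 1/2. This constant is the source of the factor exp(1/2) in the asymptotics.\<close>

lemma gauss_log_amplitude_tendsto:
  assumes "0 < lam" "0 < a0"
  shows "((\<lambda>t. gauss_log_amplitude lam a0 b0 t - psi_infinity lam a0 b0 * exp (2 * lam * t)) \<longlongrightarrow> 1 / 2) at_top"
proof (cases "a0 = lam")
  case True
  then have "(\<lambda>t. gauss_log_amplitude lam a0 b0 t - psi_infinity lam a0 b0 * exp (2 * lam * t))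
      = (\<lambda>_. 1 / 2)"
    by (simp add: fun_eq_iff gauss_log_amplitude_def gauss_psi_def psi_infinity_def algebra_simps
        flip: exp_add)
  then show ?thesis by simp
next
  case False
  define k where "k = lam - a0"
  have k: "k \<noteq> 0"
    using False by (simp add: k_def)
  have "((\<lambda>s. ln (a0 + k * s)) has_real_derivative k / a0) (at 0)"
    by (rule derivative_eq_intros refl | use assms in simp)+
  then have "((\<lambda>s. (ln (a0 + k * s) - ln a0) / s) \<longlongrightarrow> k / a0) (at 0)"
    by (simp add: DERIV_def)
  moreover have "filterlim (\<lambda>t. exp (- 2 * lam * t)) (at 0) at_top"
    using assms by real_asymp
  ultimately have "((\<lambda>t. (ln (a0 + k * exp (- 2 * lam * t)) - ln a0) / exp (- 2 * lam * t))
      \<longlongrightarrow> k / a0) at_top"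
    by (rule filterlim_compose)
  then have "((\<lambda>t. a0 / (2 * k) * ((ln (a0 + k * exp (- 2 * lam * t)) - ln a0) / exp (- 2 * lam * t)))
      \<longlongrightarrow> a0 / (2 * k) * (k / a0)) at_top"
    by (intro tendsto_mult_left)
  moreover have "a0 / (2 * k) * (k / a0) = 1 / 2"
    using assms k by simp
  moreover have "gauss_log_amplitude lam a0 b0 t - psi_infinity lam a0 b0 * exp (2 * lam * t)
      = a0 / (2 * k) * ((ln (a0 + k * exp (- 2 * lam * t)) - ln a0) / exp (- 2 * lam * t))" for t
  proof -
    have *: "gauss_psi lam a0 b0 t - psi_infinity lam a0 b0
        = a0 / (2 * k) * (ln (a0 + k * exp (- 2 * lam * t)) - ln a0)"
      using False by (simp add: gauss_psi_def psi_infinity_def gauss_denom_def k_def diff_divide_distrib algebra_simps)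
    have "gauss_log_amplitude lam a0 b0 t - psi_infinity lam a0 b0 * exp (2 * lam * t)
        = (gauss_psi lam a0 b0 t - psi_infinity lam a0 b0) * exp (2 * lam * t)"
      by (simp add: gauss_log_amplitude_def left_diff_distrib)
    also have "\<dots> = (gauss_psi lam a0 b0 t - psi_infinity lam a0 b0) / exp (- 2 * lam * t)"
      by (simp add: exp_minus divide_inverse)
    finally show ?thesis
      unfolding * by simp
  qed
  ultimately show ?thesis by (simp only:)
qed

subsection \<open>Norms of Gaussians\<close>

lemma Linf_norm_le:
  assumes "continuous_on UNIV f" "\<And>x. \<bar>f x\<bar> \<le> c"
  shows "Linf_norm f \<le> ennreal c"
  unfolding Linf_norm_def
proof (rule esssup_I)
  have "f \<in> borel_measurable borel"
    using assms(1) by (rule borel_measurable_continuous_onI)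
  then show "(\<lambda>x. ennreal \<bar>f x\<bar>) \<in> borel_measurable lborel"
    by simp
qed (use assms in \<open>auto intro: ennreal_leI\<close>)

text \<open>The set where |f| exceeds its essential supremum is null, and open by continuity; an
  open null set is empty, so the essential supremum dominates every value.\<close>

lemma Linf_norm_eq_max:
  assumes f: "continuous_on UNIV f" and le: "\<And>x. \<bar>f x\<bar> \<le> \<bar>f x0\<bar>"
  shows "Linf_norm f = ennreal \<bar>f x0\<bar>"
proof (rule antisym)
  show "Linf_norm f \<le> ennreal \<bar>f x0\<bar>"
    using assms by (rule Linf_norm_le)
  define S where "S = {x. Linf_norm f < ennreal \<bar>f x\<bar>}"
  have "open S"
    unfolding S_def using f by (intro open_Collect_less continuous_intros continuous_on_ennreal)
  have "AE x in lborel. x \<notin> S"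
    using esssup_AE[of "\<lambda>x. ennreal \<bar>f x\<bar>" lborel] unfolding S_def Linf_norm_def
    by eventually_elim auto
  then have "S \<in> null_sets lborel"
    using \<open>open S\<close> by (subst AE_iff_null_sets) auto
  then have "negligible S"
    unfolding negligible_iff_null_sets by (rule null_sets_completionI)
  then have "S = {}"
    using \<open>open S\<close> open_not_negligible by blast
  then show "ennreal \<bar>f x0\<bar> \<le> Linf_norm f"
    by (auto simp: S_def not_less)
qed

text \<open>The function |c| exp(-a x^2/2) is \<open>k\<close> times the centred normal density of
  variance 1/a, which has integral 1.\<close>

lemma L1_norm_gaussian:
  assumes "0 < a"
  shows "L1_norm (\<lambda>x. c * exp (- (a / 2) * x\<^sup>2)) = ennreal (\<bar>c\<bar> * sqrt (2 * pi / a))"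
proof -
  define \<sigma> where "\<sigma> = 1 / sqrt a"
  have \<sigma>: "\<sigma>\<^sup>2 = 1 / a"
    using assms by (simp add: \<sigma>_def power_divide)
  define k where "k = \<bar>c\<bar> * sqrt (2 * pi / a)"
  have "\<bar>c * exp (- (a / 2) * x\<^sup>2)\<bar> = k * normal_density 0 \<sigma> x" for x
    using assms by (simp add: normal_density_def \<sigma> k_def abs_mult real_sqrt_divide mult.commute)
  then have "L1_norm (\<lambda>x. c * exp (- (a / 2) * x\<^sup>2)) = (\<integral>\<^sup>+ x. ennreal (k * normal_density 0 \<sigma> x) \<partial>lborel)"
    by (simp add: L1_norm_def)
  also have "\<dots> = ennreal (\<integral>x. k * normal_density 0 \<sigma> x \<partial>lborel)"
    using assms by (intro nn_integral_eq_integral AE_I2 integrable_mult_right integrable_normal_density)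
      (auto simp: k_def \<sigma>_def)
  also have "\<dots> = ennreal k"
    using assms by (simp add: \<sigma>_def)
  finally show ?thesis by (simp add: k_def)
qed

section \<open>Distances between two Gaussians\<close>

lemma L1_norm_add_le:
  assumes [measurable]: "f \<in> borel_measurable borel" "g \<in> borel_measurable borel"
  shows "L1_norm (\<lambda>x. f x + g x) \<le> L1_norm f + L1_norm g"
proof -
  have "L1_norm (\<lambda>x. f x + g x) \<le> (\<integral>\<^sup>+ x. ennreal \<bar>f x\<bar> + ennreal \<bar>g x\<bar> \<partial>lborel)"
    unfolding L1_norm_def
    by (intro nn_integral_mono) (simp add: ennreal_plus[symmetric] del: ennreal_plus)
  also have "\<dots> = L1_norm f + L1_norm g"
    unfolding L1_norm_def by (intro nn_integral_add) auto
  finally show ?thesis .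
qed

text \<open>Gaussians with equal peak are ordered pointwise by their rates, so the difference has
  constant sign and its norm is the difference of the two integrals.\<close>

lemma L1_norm_gaussian_diff:
  assumes "0 < a" "0 < l"
  shows "L1_norm (\<lambda>x. exp (- (a / 2) * x\<^sup>2) - exp (- (l / 2) * x\<^sup>2))
    = ennreal \<bar>sqrt (2 * pi / a) - sqrt (2 * pi / l)\<bar>"
proof -
  define G where "G = (\<lambda>a x::real. exp (- (a / 2) * x\<^sup>2))"
  have main: "L1_norm (\<lambda>x. G a x - G l x) = ennreal (sqrt (2 * pi / a) - sqrt (2 * pi / l))"
    if "a \<le> l" "0 < a" for a l
  proof -
    have [measurable]: "G b \<in> borel_measurable borel" for b
      unfolding G_def by measurable
    have G: "L1_norm (G b) = ennreal (sqrt (2 * pi / b))" if "0 < b" for b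
      using L1_norm_gaussian[OF that, of 1] by (simp add: G_def)
    have le: "G l x \<le> G a x" for x
      using that by (auto simp: G_def intro: mult_right_mono)
    have "L1_norm (\<lambda>x. G a x - G l x) = (\<integral>\<^sup>+ x. ennreal \<bar>G a x\<bar> - ennreal \<bar>G l x\<bar> \<partial>lborel)"
      unfolding L1_norm_def
    proof (intro nn_integral_cong)
      fix x
      have "0 \<le> G l x" by (simp add: G_def)
      then show "ennreal \<bar>G a x - G l x\<bar> = ennreal \<bar>G a x\<bar> - ennreal \<bar>G l x\<bar>"
        using le[of x] by (simp add: ennreal_minus)
    qed
    also have "\<dots> = L1_norm (G a) - L1_norm (G l)"
      unfolding L1_norm_def
    proof (rule nn_integral_diff)
      show "(\<integral>\<^sup>+ x. ennreal \<bar>G l x\<bar> \<partial>lborel) \<noteq> \<infinity>"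
        using G[of l] that by (simp add: L1_norm_def)
      show "AE x in lborel. ennreal \<bar>G l x\<bar> \<le> ennreal \<bar>G a x\<bar>"
        using le by (intro AE_I2 ennreal_leI) (simp add: G_def)
    qed auto
    also have "\<dots> = ennreal (sqrt (2 * pi / a) - sqrt (2 * pi / l))"
      using that by (simp add: G ennreal_minus)
    finally show ?thesis .
  qed
  have le: "sqrt (2 * pi / l) \<le> sqrt (2 * pi / a)" if "a \<le> l" "0 < a" for a l
    using that by (intro real_sqrt_le_mono divide_left_mono) auto
  have "L1_norm (\<lambda>x. G a x - G l x) = ennreal \<bar>sqrt (2 * pi / a) - sqrt (2 * pi / l)\<bar>"
  proof (cases "a \<le> l")
    case True
    then show ?thesis using main[of a l] le[of a l] assms by simp
  next
    case False
    have "L1_norm (\<lambda>x. G a x - G l x) = L1_norm (\<lambda>x. G l x - G a x)"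
      unfolding L1_norm_def by (simp add: abs_minus_commute)
    with False show ?thesis using main[of l a] le[of l a] assms by simp
  qed
  then show ?thesis by (simp add: G_def)
qed

text \<open>The Gaussian is Lipschitz in its rate, uniformly in x: its derivative in a has modulus
  (x^2/2) exp(-a x^2/2) = p exp(-p) / a with p = a x^2/2, and p exp(-p) \<le> 1.\<close>

lemma gaussian_diff_le:
  fixes a l x :: real
  assumes "0 < m" "m \<le> a" "m \<le> l"
  shows "\<bar>exp (- (a / 2) * x\<^sup>2) - exp (- (l / 2) * x\<^sup>2)\<bar> \<le> \<bar>a - l\<bar> / m"
proof -
  have main: "exp (- (a / 2) * x\<^sup>2) - exp (- (l / 2) * x\<^sup>2) \<le> (l - a) / m"
    if "m \<le> a" "a \<le> l" for a l
  proof -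
    define p q where "p = a / 2 * x\<^sup>2" and "q = l / 2 * x\<^sup>2"
    have "p * exp (- p) \<le> exp p * exp (- p)"
      using exp_ge_add_one_self[of p] by (intro mult_right_mono) (linarith, simp)
    then have "p * exp (- p) \<le> 1"
      by (simp add: exp_minus)
    have "1 - (q - p) \<le> exp (p - q)"
      using exp_ge_add_one_self[of "p - q"] by linarith
    then have "exp (- p) * (1 - exp (p - q)) \<le> exp (- p) * (q - p)"
      by (intro mult_left_mono) auto
    then have "exp (- p) - exp (- q) \<le> (q - p) * exp (- p)"
      by (simp add: algebra_simps flip: exp_add)
    \<comment> \<open>Writing q - p as (l - a)/a times p leaves x only in p exp(-p).\<close>
    also have "\<dots> = (l - a) / a * (p * exp (- p))"
      using that assms by (simp add: p_def q_def field_simps)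
    also have "\<dots> \<le> (l - a) / a * 1"
      using that assms \<open>p * exp (- p) \<le> 1\<close> by (intro mult_left_mono) auto
    also have "\<dots> \<le> (l - a) / m"
      using that assms by (auto intro: divide_left_mono)
    finally show ?thesis by (simp add: p_def q_def)
  qed
  have mono: "exp (- (l / 2) * x\<^sup>2) \<le> exp (- (a / 2) * x\<^sup>2)" if "a \<le> l" for a l
    using that by (auto intro: mult_right_mono)
  show ?thesis
    using main[of a l] main[of l a] mono[of a l] mono[of l a] assms by (cases "a \<le> l") auto
qed

text \<open>Separates the error in the amplitude from the error in the rate; both norm estimates
  below apply the triangle inequality to this splitting.\<close>

lemma gaussian_diff_decomp:
  fixes c d a l x :: real
  shows "c * exp (- (a / 2) * x\<^sup>2) - d * exp (- (l / 2) * x\<^sup>2)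
    = (c - d) * exp (- (a / 2) * x\<^sup>2) + d * (exp (- (a / 2) * x\<^sup>2) - exp (- (l / 2) * x\<^sup>2))"
  by (simp add: algebra_simps)

lemma gaussian_measurable: "(\<lambda>x::real. exp (- (a / 2) * x\<^sup>2)) \<in> borel_measurable borel"
  by measurable

lemma Linf_norm_gaussian_diff_le:
  assumes "0 < m" "m \<le> a" "m \<le> l"
  shows "Linf_norm (\<lambda>x. c * exp (- (a / 2) * x\<^sup>2) - d * exp (- (l / 2) * x\<^sup>2))
    \<le> ennreal (\<bar>c - d\<bar> + \<bar>d\<bar> * (\<bar>a - l\<bar> / m))"
proof (rule Linf_norm_le)
  fix x
  have "\<bar>(c - d) * exp (- (a / 2) * x\<^sup>2)\<bar> \<le> \<bar>c - d\<bar>"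
    using assms by (simp add: abs_mult mult_left_le)
  moreover have "\<bar>d * (exp (- (a / 2) * x\<^sup>2) - exp (- (l / 2) * x\<^sup>2))\<bar> \<le> \<bar>d\<bar> * (\<bar>a - l\<bar> / m)"
    unfolding abs_mult using assms by (intro mult_left_mono gaussian_diff_le) auto
  ultimately show "\<bar>c * exp (- (a / 2) * x\<^sup>2) - d * exp (- (l / 2) * x\<^sup>2)\<bar> \<le> \<bar>c - d\<bar> + \<bar>d\<bar> * (\<bar>a - l\<bar> / m)"
    unfolding gaussian_diff_decomp by linarith
qed (intro continuous_intros)

lemma L1_norm_cmult: "f \<in> borel_measurable borel \<Longrightarrow> L1_norm (\<lambda>x. c * f x) = ennreal \<bar>c\<bar> * L1_norm f"
  unfolding L1_norm_def by (simp add: abs_mult ennreal_mult nn_integral_cmult)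

lemma L1_norm_gaussian_diff_le:
  assumes "0 < a" "0 < l"
  shows "L1_norm (\<lambda>x. c * exp (- (a / 2) * x\<^sup>2) - d * exp (- (l / 2) * x\<^sup>2))
    \<le> ennreal (\<bar>c - d\<bar> * sqrt (2 * pi / a) + \<bar>d\<bar> * \<bar>sqrt (2 * pi / a) - sqrt (2 * pi / l)\<bar>)"
proof -
  have "L1_norm (\<lambda>x. c * exp (- (a / 2) * x\<^sup>2) - d * exp (- (l / 2) * x\<^sup>2))
    \<le> L1_norm (\<lambda>x. (c - d) * exp (- (a / 2) * x\<^sup>2))
      + L1_norm (\<lambda>x. d * (exp (- (a / 2) * x\<^sup>2) - exp (- (l / 2) * x\<^sup>2)))"
    unfolding gaussian_diff_decomp by (intro L1_norm_add_le) measurable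
  also have "\<dots> = ennreal (\<bar>c - d\<bar> * sqrt (2 * pi / a))
      + ennreal \<bar>d\<bar> * ennreal \<bar>sqrt (2 * pi / a) - sqrt (2 * pi / l)\<bar>"
    using assms by (simp only: L1_norm_gaussian L1_norm_gaussian_diff L1_norm_cmult borel_measurable_diff
        gaussian_measurable)
  also have "\<dots> = ennreal (\<bar>c - d\<bar> * sqrt (2 * pi / a) + \<bar>d\<bar> * \<bar>sqrt (2 * pi / a) - sqrt (2 * pi / l)\<bar>)"
    using assms by (simp add: ennreal_plus ennreal_mult)
  finally show ?thesis .
qed

subsection \<open>Long-time behaviour\<close>

text \<open>For exponentials, equivalence requires the difference of the exponents to tend to 0;
  this is what the limit 1/2 of the log-amplitude error provides.\<close>

lemma gauss_amplitude_asymp_equiv: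
  assumes "0 < lam" "0 < a0"
  shows "(\<lambda>t. exp (gauss_log_amplitude lam a0 b0 t)) \<sim>[at_top]
    (\<lambda>t. exp (1 / 2) * exp (psi_infinity lam a0 b0 * exp (2 * lam * t)))"
proof (rule asymp_equivI')
  have "((\<lambda>t. exp (gauss_log_amplitude lam a0 b0 t - psi_infinity lam a0 b0 * exp (2 * lam * t) - 1 / 2))
      \<longlongrightarrow> exp (1 / 2 - 1 / 2)) at_top"
    by (intro tendsto_intros gauss_log_amplitude_tendsto assms)
  then show "((\<lambda>t. exp (gauss_log_amplitude lam a0 b0 t)
      / (exp (1 / 2) * exp (psi_infinity lam a0 b0 * exp (2 * lam * t)))) \<longlongrightarrow> 1) at_top"
    by (simp add: exp_diff mult.commute)
qed

lemma L1_norm_gauss_solution: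
  assumes "0 < lam" "0 < a0" "0 \<le> t"
  shows "L1_norm (gauss_solution lam a0 b0 t)
    = ennreal (exp (gauss_log_amplitude lam a0 b0 t) * sqrt (2 * pi / gauss_rate lam a0 t))"
  using L1_norm_gaussian[OF gauss_rate_pos[OF assms], of "exp (gauss_log_amplitude lam a0 b0 t)"]
  by (simp add: gauss_solution_def[abs_def])

text \<open>The norm is the amplitude times sqrt(2 pi / a(t)), and the second factor converges to a
  nonzero constant.\<close>

lemma L1_norm_gauss_solution_asymp_equiv:
  assumes "0 < lam" "0 < a0"
  shows "(\<lambda>t. enn2real (L1_norm (gauss_solution lam a0 b0 t))) \<sim>[at_top]
    (\<lambda>t. sqrt (2 * pi / lam) * exp (1 / 2) * exp (psi_infinity lam a0 b0 * exp (2 * lam * t)))"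
proof -
  have "((\<lambda>t. sqrt (2 * pi / gauss_rate lam a0 t)) \<longlongrightarrow> sqrt (2 * pi / lam)) at_top"
    using assms by (intro tendsto_intros gauss_rate_tendsto) auto
  then have "(\<lambda>t. sqrt (2 * pi / gauss_rate lam a0 t)) \<sim>[at_top] (\<lambda>_. sqrt (2 * pi / lam))"
    using assms by (intro tendsto_imp_asymp_equiv_const) auto
  from asymp_equiv_mult[OF this gauss_amplitude_asymp_equiv[OF assms]]
  have "(\<lambda>t. sqrt (2 * pi / gauss_rate lam a0 t) * exp (gauss_log_amplitude lam a0 b0 t)) \<sim>[at_top]
    (\<lambda>t. sqrt (2 * pi / lam) * exp (1 / 2) * exp (psi_infinity lam a0 b0 * exp (2 * lam * t)))"
    by (simp add: mult.assoc)
  moreover have "eventually (\<lambda>t. sqrt (2 * pi / gauss_rate lam a0 t) * exp (gauss_log_amplitude lam a0 b0 t)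
      = enn2real (L1_norm (gauss_solution lam a0 b0 t))) at_top"
    using eventually_ge_at_top[of 0]
  proof eventually_elim
    case (elim t)
    then show ?case
      using L1_norm_gauss_solution[OF assms elim, of b0] gauss_rate_pos[OF assms elim] by simp
  qed
  ultimately show ?thesis
    by (rule asymp_equiv_cong[THEN iffD1, rotated -1]) simp
qed

lemma Linf_norm_gauss_solution:
  assumes "0 < lam" "0 < a0" "0 \<le> t"
  shows "is_max_value (gauss_solution lam a0 b0 t) UNIV (exp (gauss_log_amplitude lam a0 b0 t))"
    and "Linf_norm (gauss_solution lam a0 b0 t) = ennreal (exp (gauss_log_amplitude lam a0 b0 t))"
proof -
  have le: "gauss_solution lam a0 b0 t x \<le> gauss_solution lam a0 b0 t 0" for x
    using gauss_rate_pos[OF assms] by (simp add: gauss_solution_def)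
  have at0: "gauss_solution lam a0 b0 t 0 = exp (gauss_log_amplitude lam a0 b0 t)"
    by (simp add: gauss_solution_def)
  show "is_max_value (gauss_solution lam a0 b0 t) UNIV (exp (gauss_log_amplitude lam a0 b0 t))"
    unfolding is_max_value_def using le at0 by (metis rangeI)
  have "Linf_norm (gauss_solution lam a0 b0 t) = ennreal \<bar>gauss_solution lam a0 b0 t 0\<bar>"
  proof (rule Linf_norm_eq_max)
    show "continuous_on UNIV (gauss_solution lam a0 b0 t)"
      unfolding gauss_solution_def[abs_def] by (intro continuous_intros)
    show "\<bar>gauss_solution lam a0 b0 t x\<bar> \<le> \<bar>gauss_solution lam a0 b0 t 0\<bar>" for x
      using le[of x] by (simp add: gauss_solution_def)
  qed
  then show "Linf_norm (gauss_solution lam a0 b0 t) = ennreal (exp (gauss_log_amplitude lam a0 b0 t))"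
    by (simp add: at0)
qed

text \<open>The Gaussian decreases in |x|, so its minimum over the ball sits at the
  endpoint.\<close>

lemma is_min_value_gauss_solution:
  assumes "0 < lam" "0 < a0" "0 \<le> t" "0 \<le> R"
  shows "is_min_value (gauss_solution lam a0 b0 t) {x. \<bar>x\<bar> \<le> R} (gauss_solution lam a0 b0 t R)"
  unfolding is_min_value_def
proof (intro conjI ballI)
  show "gauss_solution lam a0 b0 t R \<in> gauss_solution lam a0 b0 t ` {x. \<bar>x\<bar> \<le> R}"
    using assms by auto
  fix x assume "x \<in> {x. \<bar>x\<bar> \<le> R}"
  then have "x\<^sup>2 \<le> R\<^sup>2"
    using assms by (simp add: abs_le_square_iff[symmetric])
  then show "gauss_solution lam a0 b0 t R \<le> gauss_solution lam a0 b0 t x"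
    using gauss_rate_pos[OF assms(1-3)] by (simp add: gauss_solution_def)
qed

lemma gauss_solution_asymp_equiv:
  assumes "0 < lam" "0 < a0"
  shows "(\<lambda>t. gauss_solution lam a0 b0 t x) \<sim>[at_top]
    (\<lambda>t. exp (1 / 2) * exp (psi_infinity lam a0 b0 * exp (2 * lam * t)) * exp (- (lam / 2) * x\<^sup>2))"
  unfolding gauss_solution_def
proof (rule asymp_equiv_mult[OF gauss_amplitude_asymp_equiv[OF assms]])
  show "(\<lambda>t. exp (- (gauss_rate lam a0 t / 2) * x\<^sup>2)) \<sim>[at_top] (\<lambda>_. exp (- (lam / 2) * x\<^sup>2))"
    using assms by (intro tendsto_imp_asymp_equiv_const tendsto_intros gauss_rate_tendsto) auto
qed

text \<open>When \<open>psi_infinity\<close> vanishes, the amplitude tends to exp(1/2) and the rate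
  to \<lambda>. The explicit bounds \<open>b1\<close> and \<open>b2\<close> on the two norms then
  tend to 0 and squeeze their sum.\<close>

lemma gauss_solution_tendsto_norm:
  assumes pos: "0 < lam" "0 < a0" and psi: "psi_infinity lam a0 b0 = 0"
  defines "phi \<equiv> (\<lambda>x. exp (1 / 2) * exp (- (lam / 2) * x\<^sup>2))"
  shows "((\<lambda>t. Linf_norm (\<lambda>x. gauss_solution lam a0 b0 t x - phi x)
    + L1_norm (\<lambda>x. gauss_solution lam a0 b0 t x - phi x)) \<longlongrightarrow> 0) at_top"
proof -
  define a where "a = gauss_rate lam a0"
  define c where "c = (\<lambda>t. exp (gauss_log_amplitude lam a0 b0 t))"
  define d :: real where "d = exp (1 / 2)"
  define b1 where "b1 = (\<lambda>t. \<bar>c t - d\<bar> + \<bar>d\<bar> * (\<bar>a t - lam\<bar> / (lam / 2)))"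
  define b2 where "b2 = (\<lambda>t. \<bar>c t - d\<bar> * sqrt (2 * pi / a t)
    + \<bar>d\<bar> * \<bar>sqrt (2 * pi / a t) - sqrt (2 * pi / lam)\<bar>)"
  have a: "(a \<longlongrightarrow> lam) at_top"
    unfolding a_def by (rule gauss_rate_tendsto[OF pos])
  have c: "(c \<longlongrightarrow> d) at_top"
    unfolding c_def d_def using gauss_log_amplitude_tendsto[OF pos, of b0] psi by (intro tendsto_exp) simp
  have "(b1 \<longlongrightarrow> \<bar>d - d\<bar> + \<bar>d\<bar> * (\<bar>lam - lam\<bar> / (lam / 2))) at_top"
    unfolding b1_def using pos by (intro tendsto_intros a c) auto
  then have b1: "(b1 \<longlongrightarrow> 0) at_top" by simp
  have "(b2 \<longlongrightarrow> \<bar>d - d\<bar> * sqrt (2 * pi / lam)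
      + \<bar>d\<bar> * \<bar>sqrt (2 * pi / lam) - sqrt (2 * pi / lam)\<bar>) at_top"
    unfolding b2_def using pos by (intro tendsto_intros a c) auto
  then have b2: "(b2 \<longlongrightarrow> 0) at_top" by simp
  have "((\<lambda>t. ennreal (b1 t) + ennreal (b2 t)) \<longlongrightarrow> ennreal 0 + ennreal 0) at_top"
    using b1 b2 by (intro tendsto_add tendsto_ennrealI)
  then have lim: "((\<lambda>t. ennreal (b1 t) + ennreal (b2 t)) \<longlongrightarrow> 0) at_top" by simp
  \<comment> \<open>Supplies the common lower bound m = \<lambda>/2 for both rates in the sup-norm
    estimate.\<close>
  have "eventually (\<lambda>t. lam / 2 < a t) at_top"
    using a pos by (intro order_tendstoD(1)[OF a]) simp
  then have "eventually (\<lambda>t. Linf_norm (\<lambda>x. gauss_solution lam a0 b0 t x - phi x)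
      + L1_norm (\<lambda>x. gauss_solution lam a0 b0 t x - phi x) \<le> ennreal (b1 t) + ennreal (b2 t)) at_top"
  proof eventually_elim
    case (elim t)
    then show ?case
      using Linf_norm_gaussian_diff_le[of "lam / 2" "a t" lam "c t" d] pos
        L1_norm_gaussian_diff_le[of "a t" lam "c t" d]
      unfolding gauss_solution_def phi_def a_def[symmetric] b1_def b2_def c_def d_def
      by (intro add_mono) auto
  qed
  then show ?thesis
    by (intro tendsto_sandwich[OF _ _ tendsto_const lim]) auto
qed

theorem corollary4p2:
  fixes lam a0 b0 :: real and u :: "real \<Rightarrow> real \<Rightarrow> real"
  assumes "lam > 0" and "b0 > 0" and "a0 > 0"
    and "log_heat_solution lam (\<lambda>x. b0 * exp (- (a0 / 2) * x\<^sup>2)) u"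
  shows
    "(psi_infinity lam a0 b0 < 0 \<longrightarrow>
        (\<exists>M. (\<forall>t\<ge>0. is_max_value (u t) UNIV (M t) \<and> Linf_norm (u t) = ennreal (M t)) \<and>
             M \<sim>[at_top] (\<lambda>t. exp (1 / 2) * exp (psi_infinity lam a0 b0 * exp (2 * lam * t)))) \<and>
        (\<lambda>t. enn2real (L1_norm (u t))) \<sim>[at_top]
          (\<lambda>t. sqrt (2 * pi / lam) * exp (1 / 2) *
                 exp (psi_infinity lam a0 b0 * exp (2 * lam * t)))) \<and>
     (psi_infinity lam a0 b0 = 0 \<longrightarrow>
        (let phi = (\<lambda>x. exp (1 / 2) * exp (- (lam / 2) * x\<^sup>2)) in
          ((\<lambda>t. Linf_norm (\<lambda>x. u t x - phi x) + L1_norm (\<lambda>x. u t x - phi x)) \<longlongrightarrow> 0) at_top)) \<and>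
     (psi_infinity lam a0 b0 > 0 \<longrightarrow>
        (\<forall>R>0. \<exists>m. (\<forall>t\<ge>0. is_min_value (u t) {x. \<bar>x\<bar> \<le> R} (m t)) \<and>
             m \<sim>[at_top]
               (\<lambda>t. exp (1 / 2) * exp (psi_infinity lam a0 b0 * exp (2 * lam * t)) *
                      exp (- (lam / 2) * R\<^sup>2))) \<and>
        (\<lambda>t. enn2real (L1_norm (u t))) \<sim>[at_top]
          (\<lambda>t. sqrt (2 * pi / lam) * exp (1 / 2) *
                 exp (psi_infinity lam a0 b0 * exp (2 * lam * t))))"
proof -
  define U where "U = gauss_solution lam a0 b0"
  \<comment> \<open>Uniqueness identifies the solution only for t \<ge> 0, where its values are
    meaningful; the limits at infinity see nothing else.\<close>
  have u: "u t = U t" if "0 \<le> t" for t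
    unfolding U_def using assms that
    by (intro log_heat_solution_unique[OF _ assms(4) log_heat_solution_gauss]) auto
  then have u_ev: "eventually (\<lambda>t. u t = U t) at_top"
    using eventually_ge_at_top[of 0] by (rule eventually_mono[rotated])
  have L1: "(\<lambda>t. enn2real (L1_norm (u t))) \<sim>[at_top]
      (\<lambda>t. sqrt (2 * pi / lam) * exp (1 / 2) * exp (psi_infinity lam a0 b0 * exp (2 * lam * t)))"
  proof (rule asymp_equiv_cong[THEN iffD1])
    show "eventually (\<lambda>t. enn2real (L1_norm (U t)) = enn2real (L1_norm (u t))) at_top"
      using u_ev by eventually_elim simp
  qed (use assms L1_norm_gauss_solution_asymp_equiv[of lam a0 b0] in \<open>simp_all add: U_def\<close>)
  have sup: "\<exists>M. (\<forall>t\<ge>0. is_max_value (u t) UNIV (M t) \<and> Linf_norm (u t) = ennreal (M t)) \<and>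
      M \<sim>[at_top] (\<lambda>t. exp (1 / 2) * exp (psi_infinity lam a0 b0 * exp (2 * lam * t)))"
    using Linf_norm_gauss_solution[of lam a0 _ b0] gauss_amplitude_asymp_equiv[of lam a0 b0] assms(1,3)
    \<comment> \<open>The witness is the value at the peak x = 0.\<close>
    by (intro exI[of _ "\<lambda>t. exp (gauss_log_amplitude lam a0 b0 t)"]) (simp add: u U_def)
  have min: "\<exists>m. (\<forall>t\<ge>0. is_min_value (u t) {x. \<bar>x\<bar> \<le> R} (m t)) \<and>
      m \<sim>[at_top] (\<lambda>t. exp (1 / 2) * exp (psi_infinity lam a0 b0 * exp (2 * lam * t)) *
        exp (- (lam / 2) * R\<^sup>2))" if "R > 0" for R
    using is_min_value_gauss_solution[of lam a0 _ R b0] gauss_solution_asymp_equiv[of lam a0 b0 R] assms(1,3) that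
    by (intro exI[of _ "\<lambda>t. U t R"]) (simp add: u U_def)
  have lim: "((\<lambda>t. Linf_norm (\<lambda>x. u t x - exp (1 / 2) * exp (- (lam / 2) * x\<^sup>2))
      + L1_norm (\<lambda>x. u t x - exp (1 / 2) * exp (- (lam / 2) * x\<^sup>2))) \<longlongrightarrow> 0) at_top"
    if "psi_infinity lam a0 b0 = 0"
  proof (rule Lim_transform_eventually)
    show "((\<lambda>t. Linf_norm (\<lambda>x. U t x - exp (1 / 2) * exp (- (lam / 2) * x\<^sup>2))
        + L1_norm (\<lambda>x. U t x - exp (1 / 2) * exp (- (lam / 2) * x\<^sup>2))) \<longlongrightarrow> 0) at_top"
      unfolding U_def by (rule gauss_solution_tendsto_norm[OF assms(1,3) that])
    show "eventually (\<lambda>t. Linf_norm (\<lambda>x. U t x - exp (1 / 2) * exp (- (lam / 2) * x\<^sup>2))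
        + L1_norm (\<lambda>x. U t x - exp (1 / 2) * exp (- (lam / 2) * x\<^sup>2))
      = Linf_norm (\<lambda>x. u t x - exp (1 / 2) * exp (- (lam / 2) * x\<^sup>2))
        + L1_norm (\<lambda>x. u t x - exp (1 / 2) * exp (- (lam / 2) * x\<^sup>2))) at_top"
      using u_ev by eventually_elim simp
  qed
  show ?thesis
    unfolding Let_def using L1 sup min lim by blast
qed

end
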